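(* Let $X$ be a real Hilbert space, $\alpha>0$, and let $A:X\to X$ be $\alpha$-cocoercive. Then for any $x,z\in X$, $$A(z)\in A^{[\varepsilon]}(x),\qquad\text{with } \varepsilon=\frac{\|x-z\|^2}{4\alpha}.$$
   Context: A (maximal) monotone operator $A:X\to X$ is $\alpha$-cocoercive ($\alpha>0$) if $\langle x-y,Ax-Ay\rangle\ge\alpha\|Ax-Ay\|^2$ for all $x,y\in X$. For a maximal monotone operator $T:X\rightrightarrows X$ (point-to-set; a single-valued map is identified with a singleton-valued point-to-set map) and $\varepsilon\ge 0$, the $\varepsilon$-enlargement of $T$ is $$T^{[\varepsilon]}(x)=\{v\in X : \langle x-y,v-u\rangle\ge-\varepsilon\ \text{ for all } y\in X,\ u\in T(y)\}.$$ *)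

theory Defs
  imports "HOL-Analysis.Analysis"
begin

text \<open>
  A real Hilbert space is a type of sort \<open>{real_inner, complete_space}\<close>.
  A point-to-set operator \<open>T : X \<rightrightarrows> X\<close> is a function \<open>'a \<Rightarrow> 'a set\<close>; a single-valued map \<open>A\<close> is
  identified with \<open>\<lambda>x. {A x}\<close>.
\<close>

definition monotone_operator :: "('a::real_inner \<Rightarrow> 'a set) \<Rightarrow> bool" where
  "monotone_operator T \<longleftrightarrow>
     (\<forall>x y. \<forall>u\<in>T x. \<forall>v\<in>T y. (x - y) \<bullet> (u - v) \<ge> 0)"

definition maximal_monotone_operator :: "('a::real_inner \<Rightarrow> 'a set) \<Rightarrow> bool" where
  "maximal_monotone_operator T \<longleftrightarrow>
     monotone_operator T \<and>
     (\<forall>S. monotone_operator S \<and> (\<forall>x. T x \<subseteq> S x) \<longrightarrow> S = T)"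

abbreviation point_to_set :: "('a \<Rightarrow> 'a) \<Rightarrow> 'a \<Rightarrow> 'a set" where
  "point_to_set A \<equiv> (\<lambda>x. {A x})"

text \<open>
  Maximal monotonicity is not listed as a separate requirement: for \<open>\<alpha> > 0\<close> it follows from the
  inequality, see \<open>cocoercive_imp_maximal_monotone\<close> below.
\<close>

definition cocoercive :: "real \<Rightarrow> ('a::real_inner \<Rightarrow> 'a) \<Rightarrow> bool" where
  "cocoercive \<alpha> A \<longleftrightarrow> (\<forall>x y. (x - y) \<bullet> (A x - A y) \<ge> \<alpha> * (norm (A x - A y))\<^sup>2)"

definition enlargement :: "real \<Rightarrow> ('a::real_inner \<Rightarrow> 'a set) \<Rightarrow> 'a \<Rightarrow> 'a set" where
  "enlargement \<epsilon> T x = {v. \<forall>y. \<forall>u\<in>T y. (x - y) \<bullet> (v - u) \<ge> - \<epsilon>}"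

lemma cocoercive_imp_maximal_monotone:
  fixes A :: "'a::real_inner \<Rightarrow> 'a"
  assumes "\<alpha> > 0" and coc: "cocoercive \<alpha> A"
  shows "maximal_monotone_operator (point_to_set A)"
proof -
  have ineq: "\<alpha> * (norm (A x - A y))\<^sup>2 \<le> (x - y) \<bullet> (A x - A y)" for x y
    using coc by (auto simp: cocoercive_def)
  have mono: "monotone_operator (point_to_set A)"
  proof -
    have "0 \<le> (x - y) \<bullet> (A x - A y)" for x y
      by (rule order_trans[OF _ ineq]) (use \<open>\<alpha> > 0\<close> in simp)
    then show ?thesis by (simp add: monotone_operator_def)
  qed
  have lip: "\<alpha> * norm (A x - A y) \<le> norm (x - y)" for x y
  proof (cases "A x = A y")
    case False
    have "\<alpha> * (norm (A x - A y))\<^sup>2 \<le> norm (x - y) * norm (A x - A y)"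
      using ineq norm_cauchy_schwarz order_trans by blast
    then have "(\<alpha> * norm (A x - A y)) * norm (A x - A y) \<le> norm (x - y) * norm (A x - A y)"
      by (simp add: power2_eq_square mult.assoc)
    then show ?thesis using False by simp
  qed simp
  have only: "v = A x" if S: "monotone_operator S" "\<forall>x. {A x} \<subseteq> S x" and v: "v \<in> S x" for S x v
  proof -
    define w where "w = v - A x"
    define y where "y = x + (\<alpha> / 2) *\<^sub>R w"
    have "(x - y) \<bullet> (v - A y) \<ge> 0"
      using S v by (auto simp: monotone_operator_def)
    then have "w \<bullet> (v - A y) \<le> 0"
      using \<open>\<alpha> > 0\<close> by (simp add: y_def mult_le_0_iff)
    then have "w \<bullet> w \<le> w \<bullet> (A y - A x)"
      by (simp add: w_def inner_diff_right)
    also have "\<dots> \<le> norm w * norm (A y - A x)"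
      by (rule norm_cauchy_schwarz)
    also have "\<dots> \<le> norm w * (norm w / 2)"
    proof (rule mult_left_mono)
      have "\<alpha> * norm (A y - A x) \<le> \<alpha> * (norm w / 2)"
        using lip[of y x] \<open>\<alpha> > 0\<close> by (simp add: y_def)
      then show "norm (A y - A x) \<le> norm w / 2"
        using \<open>\<alpha> > 0\<close> by simp
    qed simp
    finally have "(norm w)\<^sup>2 \<le> (norm w)\<^sup>2 / 2"
      by (simp only: power2_norm_eq_inner[symmetric]) (simp add: power2_eq_square)
    then show ?thesis by (simp add: w_def)
  qed
  have "S = point_to_set A" if S: "monotone_operator S" "\<forall>x. {A x} \<subseteq> S x" for S
  proof
    fix x
    show "S x = {A x}"
      using S(2) only[OF S] by auto
  qed
  with mono show ?thesis
    unfolding maximal_monotone_operator_def by blast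
qed

end

theory Submission
  imports Defs
begin

text \<open>Put \<open>w = A z - A y\<close> and split \<open>x - y = (z - y) + (x - z)\<close>.
  Cocoercivity at the pair \<open>z\<close>, \<open>y\<close> makes the first part contribute at
  least \<open>\<alpha> * (norm w)\<^sup>2\<close>; by Cauchy-Schwarz the second costs at most
  \<open>norm (x - z) * norm w\<close>. The resulting quadratic in \<open>norm w\<close> is bounded
  below independently of \<open>y\<close>, and its minimum over the reals is exactly minus the
  claimed enlargement parameter.\<close>

theorem lemma2p8:
  fixes A :: "'a::{real_inner, complete_space} \<Rightarrow> 'a" and \<alpha> :: real and x z :: 'a
  assumes "\<alpha> > 0" and "cocoercive \<alpha> A"
  shows "A z \<in> enlargement ((norm (x - z))\<^sup>2 / (4 * \<alpha>)) (point_to_set A) x"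
proof -
  have "- ((norm (x - z))\<^sup>2 / (4 * \<alpha>)) \<le> (x - y) \<bullet> (A z - A y)" for y
  proof -
    define w where "w = A z - A y"
    \<comment> \<open>Completing the square: the quadratic
      \<open>\<alpha> * t\<^sup>2 - norm (x - z) * t\<close> is minimal at
      \<open>t = norm (x - z) / (2 * \<alpha>)\<close>, where this square vanishes.\<close>
    have "0 \<le> (2 * \<alpha> * norm w - norm (x - z))\<^sup>2 / (4 * \<alpha>)"
      using \<open>\<alpha> > 0\<close> by simp
    also have "\<dots> = \<alpha> * (norm w)\<^sup>2 - norm (x - z) * norm w + (norm (x - z))\<^sup>2 / (4 * \<alpha>)"
      using \<open>\<alpha> > 0\<close> by (simp add: field_simps power2_eq_square)
    finally have "- ((norm (x - z))\<^sup>2 / (4 * \<alpha>)) \<le> \<alpha> * (norm w)\<^sup>2 - norm (x - z) * norm w"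
      by linarith
    \<comment> \<open>The detour through \<open>z\<close> is needed because cocoercivity pairs
      \<open>A z\<close> with its own argument \<open>z\<close>, not with \<open>x\<close>.\<close>
    also have "\<dots> \<le> (z - y) \<bullet> w + (x - z) \<bullet> w"
    proof -
      have "\<alpha> * (norm w)\<^sup>2 \<le> (z - y) \<bullet> w"
        using assms(2) by (simp add: cocoercive_def w_def)
      moreover have "- (norm (x - z) * norm w) \<le> (x - z) \<bullet> w"
        using Cauchy_Schwarz_ineq2[of "x - z" w] by linarith
      ultimately show ?thesis by linarith
    qed
    also have "\<dots> = (x - y) \<bullet> w"
      by (simp add: inner_diff_left)
    finally show ?thesis by (simp add: w_def)
  qed
  then show ?thesis by (simp add: enlargement_def)
qed

end
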